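(* Let $B\subset S$ be any set of patterns with $1\notin B$. Suppose that $D[B]$ is a backward path-directed graph with parameters $V'=\{v_0,v_1,\dots\}$, $W$ and $a\geq 0$. If $\sum_{j\geq0}M[B](v_j,w)x^j$ is a rational generating function for every $w\in W$, then $G_B(x)$ is a rational generating function of $x$ and $$t_0:=\frac{1+x-ax-\sqrt{(1+x-ax)(1-3x-ax)}}{2x(1+x-ax)},$$ i.e. $G_B(x)$ can be expressed as a rational function in $x$ and $t_0$ (where $t_0$ is regarded as a power series in $x$).
   Context: Permutations and patterns. $S_n$ is the set of permutations of $[n]=\{1,\dots,n\}$ written as words, $S=\bigcup_{n\ge1}S_n$, and $|\pi|=n$ for $\pi\in S_n$. The permutation of length one is denoted $1$. A permutation $\sigma\in S_n$ contains $\tau\in S_k$ if there are indices $i_1<\dots<i_k$ such that $\sigma(i_a)<\sigma(i_b)$ iff $\tau(a)<\tau(b)$ for all $a,b$; otherwise it avoids $\tau$. $S_n(B)$ is the set of permutations in $S_n$ avoiding every $\tau\in B$, $S(B)=\bigcup_{n\ge 1}S_n(B)$, and $G_B(x)=\sum_{n\ge1}|S_n(B)|x^n$. Pattern-avoidance tree. $T(B)$ is the rooted tree with root $1$ whose $n$-th level is $S_n(B)$ (the root is level $1$); the parent of $\pi\in S_n(B)$, $n\ge2$, is the permutation in $S_{n-1}(B)$ obtained by deleting the letter $n$ from $\pi$. For $\pi\in S(B)$, $T(B;\pi)$ is the subtree of $T(B)$ consisting of $\pi$ and all its descendants, with root $\pi$. Call $\pi,\pi'\in S(B)$ equivalent if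 $T(B;\pi)\cong T(B;\pi')$ as rooted trees. Each equivalence class is labeled by one fixed representative of minimal length in the class. The directed graph $D[B]$ and matrix $M[B]$. The nodes of $D[B]$ are these representatives (one per equivalence class). For nodes $v,w$, the number of edges from $v$ to $w$ is the number of children of $v$ in $T(B)$ that are equivalent to $w$ (so loops and multiple edges are allowed); this number is denoted $M[B](v,w)$. The length $|v|$ of a node $v$ is its length as a permutation. Backward path-directed graphs. A directed graph $G=(V,E)$ with $V\subset S$ (edges may have multiplicities) is backward path-directed with parameters $V'$, $W$ and $a$ if $V$ is partitioned as $V=V'\cup W$, where $V'=\{v_0,v_1,\dots\}$ and $|v_i|=i+m$ for all $i\ge0$ with $m\ge1$ fixed, such that: (i) every node in $W=V\setminus V'$ has length at most $m$; (ii) for each $j\ge0$, $(v_j,v_i)\in E$ for all $i=0,1,\dots,j-1,j+1$, with each of these edges occurring exactly once, and additionally, for some fixed integer $a\ge0$, there are exactly $a$ loops at the node $v_i$ for all $i\ge0$; (iii) all other edges $(c,d)\in E$ may be repeated (with $c=d$ possible) and are such that $c$ or $d$ belongs to $W$ (possibly both). *)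

theory Defs
  imports "HOL-Combinatorics.Multiset_Permutations" "HOL-Computational_Algebra.Computational_Algebra"
begin

type_synonym perm = "nat list"

definition S_n :: "nat \<Rightarrow> perm set" where
  "S_n n = permutations_of_set {1..n}"

definition S :: "perm set" where
  "S = (\<Union>n\<in>{1..}. S_n n)"

text \<open>Positions of a word are numbered from 0, as usual for lists; the letters are \<open>1, \<dots>, n\<close>.\<close>

definition pat_contains :: "perm \<Rightarrow> perm \<Rightarrow> bool" where
  "pat_contains \<sigma> \<tau> \<longleftrightarrow>
     (\<exists>i. strict_mono_on {..<length \<tau>} i \<and> i ` {..<length \<tau>} \<subseteq> {..<length \<sigma>} \<and>
          (\<forall>a<length \<tau>. \<forall>b<length \<tau>. \<sigma> ! i a < \<sigma> ! i b \<longleftrightarrow> \<tau> ! a < \<tau> ! b))"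

definition Av_n :: "perm set \<Rightarrow> nat \<Rightarrow> perm set" where
  "Av_n B n = {\<pi> \<in> S_n n. \<forall>\<tau>\<in>B. \<not> pat_contains \<pi> \<tau>}"

definition Av :: "perm set \<Rightarrow> perm set" where
  "Av B = (\<Union>n\<in>{1..}. Av_n B n)"

definition Av_gf :: "perm set \<Rightarrow> real fps" where
  "Av_gf B = Abs_fps (\<lambda>n. if n = 0 then 0 else of_nat (card (Av_n B n)))"

text \<open>A rooted tree is given by its vertices, its edges (directed from parent to child) and its root.\<close>

type_synonym 'a rooted_tree = "'a set \<times> ('a \<times> 'a) set \<times> 'a"

definition rooted_tree_iso :: "'a rooted_tree \<Rightarrow> 'b rooted_tree \<Rightarrow> bool" where
  "rooted_tree_iso T T' \<longleftrightarrow>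
     (case T of (V, E, r) \<Rightarrow> case T' of (V', E', r') \<Rightarrow>
        \<exists>f. bij_betw f V V' \<and> f r = r' \<and>
            (\<forall>x\<in>V. \<forall>y\<in>V. (x, y) \<in> E \<longleftrightarrow> (f x, f y) \<in> E'))"

definition perm_parent :: "perm \<Rightarrow> perm" where
  "perm_parent \<pi> = remove1 (length \<pi>) \<pi>"

definition tree_edges :: "perm set \<Rightarrow> (perm \<times> perm) set" where
  "tree_edges B = {(\<sigma>, \<pi>). \<sigma> \<in> Av B \<and> \<pi> \<in> Av B \<and> length \<pi> \<ge> 2 \<and> \<sigma> = perm_parent \<pi>}"

definition children :: "perm set \<Rightarrow> perm \<Rightarrow> perm set" where
  "children B \<pi> = {\<rho>. (\<pi>, \<rho>) \<in> tree_edges B}"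

definition subtree :: "perm set \<Rightarrow> perm \<Rightarrow> perm rooted_tree" where
  "subtree B \<pi> =
     (let D = (tree_edges B)\<^sup>* `` {\<pi>} in (D, tree_edges B \<inter> D \<times> D, \<pi>))"

definition perm_equiv :: "perm set \<Rightarrow> perm \<Rightarrow> perm \<Rightarrow> bool" where
  "perm_equiv B \<pi> \<pi>' \<longleftrightarrow> rooted_tree_iso (subtree B \<pi>) (subtree B \<pi>')"

text \<open>\<open>D[B]\<close> depends on a choice of one minimal-length representative per equivalence class;
  \<open>node_set B V\<close> says that \<open>V\<close> is such a choice. A directed graph with multiple edges is given by
  its nodes together with the function assigning to a pair of nodes the number of edges between
  them, so that \<open>D[B]\<close> is the pair of \<open>V\<close> and \<open>edge_mult B\<close>.\<close>

definition node_set :: "perm set \<Rightarrow> perm set \<Rightarrow> bool" where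
  "node_set B V \<longleftrightarrow>
     V \<subseteq> Av B \<and>
     (\<forall>\<pi>\<in>Av B. \<exists>!v. v \<in> V \<and> perm_equiv B \<pi> v) \<and>
     (\<forall>v\<in>V. \<forall>\<pi>\<in>Av B. perm_equiv B v \<pi> \<longrightarrow> length v \<le> length \<pi>)"

definition edge_mult :: "perm set \<Rightarrow> perm \<Rightarrow> perm \<Rightarrow> nat" where
  "edge_mult B v w = card {\<rho> \<in> children B v. perm_equiv B \<rho> w}"

text \<open>The set \<open>V'\<close> is \<open>range v\<close>. The last conjunct concerns exactly the edges that are neither
  edges \<open>(v j, v i)\<close> with \<open>i < j\<close> or \<open>i = j + 1\<close> nor loops \<open>(v i, v i)\<close>.\<close>

definition backward_path_directed ::
    "perm set \<Rightarrow> (perm \<Rightarrow> perm \<Rightarrow> nat) \<Rightarrow> (nat \<Rightarrow> perm) \<Rightarrow> perm set \<Rightarrow> nat \<Rightarrow> bool" where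
  "backward_path_directed V M v W a \<longleftrightarrow>
     V \<subseteq> S \<and> V = range v \<union> W \<and> range v \<inter> W = {} \<and>
     (\<exists>m\<ge>1. (\<forall>i. length (v i) = i + m) \<and> (\<forall>w\<in>W. length w \<le> m)) \<and>
     (\<forall>j. \<forall>i\<in>{..<j} \<union> {j + 1}. M (v j) (v i) = 1) \<and>
     (\<forall>i. M (v i) (v i) = a) \<and>
     (\<forall>c\<in>V. \<forall>d\<in>V. M c d > 0 \<longrightarrow>
        (\<exists>j. \<exists>i\<in>{..<j} \<union> {j, j + 1}. c = v j \<and> d = v i) \<or> c \<in> W \<or> d \<in> W)"

definition rational_fps :: "real fps \<Rightarrow> bool" where
  "rational_fps f \<longleftrightarrow>
     (\<exists>p q :: real poly. q \<noteq> 0 \<and> f * fps_of_poly q = fps_of_poly p)"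

text \<open>A bivariate polynomial is a polynomial over \<open>real poly\<close>: the inner variable is replaced by
  \<open>x\<close>, the outer one by the power series \<open>t\<close>.\<close>

definition eval2 :: "real poly poly \<Rightarrow> real fps \<Rightarrow> real fps" where
  "eval2 P t = poly (map_poly fps_of_poly P) t"

definition rational_in_x_and :: "real fps \<Rightarrow> real fps \<Rightarrow> bool" where
  "rational_in_x_and t f \<longleftrightarrow>
     (\<exists>P Q :: real poly poly. eval2 Q t \<noteq> 0 \<and> f * eval2 Q t = eval2 P t)"

text \<open>The radicand has constant coefficient \<open>1\<close>, and \<open>fps_radical root 2\<close> is its square root with
  constant coefficient \<open>1\<close>. The numerator of \<open>t0\<close> has constant coefficient \<open>0\<close>, so
  the division by a multiple of \<open>x\<close> is exact in the ring of power series.\<close>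

definition t0 :: "nat \<Rightarrow> real fps" where
  "t0 a =
     (1 + fps_X - of_nat a * fps_X
        - fps_radical root 2 ((1 + fps_X - of_nat a * fps_X) * (1 - 3 * fps_X - of_nat a * fps_X)))
     / (2 * fps_X * (1 + fps_X - of_nat a * fps_X))"

end

theory Submission
  imports Defs
begin

text \<open>For a node \<open>u\<close> let \<open>F u\<close> be the series counting the vertices below \<open>u\<close> by relative depth. Then
  \<open>F u = 1 + x (\<Sum>w. M(u, w) F w)\<close> and \<open>G\<^sub>B = x F 1\<close>. On the path \<open>v\<^sub>0, v\<^sub>1, \<dots>\<close> the kernel method
  applies: with \<open>A(y) = \<Sum>j. A\<^sub>j y\<^sup>j\<close>, a system
  \<open>A\<^sub>j = r\<^sub>j + x (A\<^sub>0 + \<dots> + A\<^sub>j\<^sub>-\<^sub>1 + a A\<^sub>j + A\<^sub>j\<^sub>+\<^sub>1)\<close> becomes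
  \<open>A(y) (1 - x y / (1 - y) - a x - x / y) = R(y) - x A\<^sub>0 / y\<close>, and the kernel vanishes at
  \<open>y = x t\<^sub>0\<close>, so \<open>A\<^sub>0 = t\<^sub>0 R(x t\<^sub>0)\<close>, and the recurrence then gives every \<open>A\<^sub>j\<close>. By superposition
  each \<open>F (v j)\<close> is an affine combination of the finitely many \<open>F w\<close>, \<open>w \<in> W\<close>, with coefficients
  rational in \<open>x\<close> and \<open>t\<^sub>0\<close>. Substituting this into the equations of \<open>W\<close> leaves a finite linear
  system congruent to the identity modulo \<open>x\<close>, hence solvable over the same ring.\<close>

subsection \<open>Series rational in \<open>x\<close> and \<open>t\<close>\<close>

lemma eval2_0 [simp]: "eval2 0 t = 0"
  by (simp add: eval2_def)

text \<open>This Horner step lets the homomorphism properties of \<open>eval2\<close> follow by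
  induction over \<open>pCons\<close>.\<close>

lemma eval2_pCons [simp]: "eval2 (pCons c P) t = fps_of_poly c + t * eval2 P t"
  by (simp add: eval2_def map_poly_pCons)

lemma eval2_add: "eval2 (P + Q) t = eval2 P t + eval2 Q t"
  by (induction P Q rule: poly_induct2) (simp_all add: fps_of_poly_add algebra_simps)

lemma eval2_smult: "eval2 (smult c P) t = fps_of_poly c * eval2 P t"
  by (induction P) (simp_all add: fps_of_poly_mult algebra_simps)

lemma eval2_mult: "eval2 (P * Q) t = eval2 P t * eval2 Q t"
  by (induction P) (simp_all add: eval2_add eval2_smult algebra_simps)

lemma rational_in_x_and_fps_of_poly: "rational_in_x_and t (fps_of_poly p)"
  unfolding rational_in_x_and_def
  by (rule exI[of _ "[:p:]"], rule exI[of _ "[:1:]"]) simp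

lemma rational_in_x_and_generator: "rational_in_x_and t t"
  unfolding rational_in_x_and_def
  by (rule exI[of _ "[:0, 1:]"], rule exI[of _ "[:1:]"]) simp

lemma rational_in_x_and_const: "rational_in_x_and t (fps_const c)"
  using rational_in_x_and_fps_of_poly[of t "[:c:]"] by (simp add: fps_of_poly_const)

lemma rational_in_x_and_0: "rational_in_x_and t 0"
  using rational_in_x_and_const[of t 0] by simp

lemma rational_in_x_and_1: "rational_in_x_and t 1"
  using rational_in_x_and_const[of t 1] by simp

lemma rational_in_x_and_of_nat: "rational_in_x_and t (of_nat n)"
  using rational_in_x_and_const[of t "of_nat n"] by (simp add: fps_of_nat)

lemma rational_in_x_and_X: "rational_in_x_and t fps_X"
  using rational_in_x_and_fps_of_poly[of t "[:0, 1:]"] by (simp add: fps_of_poly_pCons)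

lemma rational_in_x_and_add:
  assumes "rational_in_x_and t f" "rational_in_x_and t g"
  shows "rational_in_x_and t (f + g)"
proof -
  obtain P Q P' Q' where "eval2 Q t \<noteq> 0" "f * eval2 Q t = eval2 P t"
    "eval2 Q' t \<noteq> 0" "g * eval2 Q' t = eval2 P' t"
    using assms unfolding rational_in_x_and_def by metis
  then have "eval2 (Q * Q') t \<noteq> 0"
    and "(f + g) * eval2 (Q * Q') t = eval2 (P * Q' + P' * Q) t"
    by (simp_all add: eval2_mult eval2_add algebra_simps)
  then show ?thesis unfolding rational_in_x_and_def by blast
qed

lemma rational_in_x_and_mult:
  assumes "rational_in_x_and t f" "rational_in_x_and t g"
  shows "rational_in_x_and t (f * g)"
proof -
  obtain P Q P' Q' where "eval2 Q t \<noteq> 0" and 1: "f * eval2 Q t = eval2 P t"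
    and "eval2 Q' t \<noteq> 0" and 2: "g * eval2 Q' t = eval2 P' t"
    using assms unfolding rational_in_x_and_def by metis
  then have "eval2 (Q * Q') t \<noteq> 0"
    by (simp add: eval2_mult)
  moreover have "(f * g) * eval2 (Q * Q') t = eval2 (P * P') t"
    unfolding eval2_mult 1[symmetric] 2[symmetric] by (simp add: algebra_simps)
  ultimately show ?thesis unfolding rational_in_x_and_def by blast
qed

lemma rational_in_x_and_diff:
  assumes "rational_in_x_and t f" "rational_in_x_and t g"
  shows "rational_in_x_and t (f - g)"
proof -
  have "rational_in_x_and t (f + fps_const (-1) * g)"
    by (intro rational_in_x_and_add rational_in_x_and_mult rational_in_x_and_const assms)
  then show ?thesis
    by (simp flip: fps_const_neg)
qed

lemma rational_in_x_and_sum: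
  assumes "\<And>i. i \<in> I \<Longrightarrow> rational_in_x_and t (f i)"
  shows "rational_in_x_and t (\<Sum>i\<in>I. f i)"
  using assms
  by (induction I rule: infinite_finite_induct)
    (simp_all add: rational_in_x_and_0 rational_in_x_and_add)

text \<open>This is closure under division, phrased for a quotient \<open>f\<close> already known to
  be a series. It therefore also covers divisors that are not units, such as
  \<open>fps_X\<close>.\<close>

lemma rational_in_x_and_cancel:
  assumes "rational_in_x_and t g" "rational_in_x_and t (f * g)" "g \<noteq> 0"
  shows "rational_in_x_and t f"
proof -
  obtain P Q P' Q' where Q: "eval2 Q t \<noteq> 0" "g * eval2 Q t = eval2 P t"
    and Q': "eval2 Q' t \<noteq> 0" "(f * g) * eval2 Q' t = eval2 P' t"
    using assms unfolding rational_in_x_and_def by metis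
  have "eval2 (P * Q') t \<noteq> 0"
    using Q Q' assms(3) by (simp add: eval2_mult flip: Q(2))
  moreover have "f * eval2 (P * Q') t = eval2 (P' * Q) t"
    by (simp add: eval2_mult algebra_simps flip: Q(2) Q'(2))
  ultimately show ?thesis unfolding rational_in_x_and_def by blast
qed

lemmas rational_in_x_and_intros =
  rational_in_x_and_generator rational_in_x_and_const rational_in_x_and_0 rational_in_x_and_1
  rational_in_x_and_of_nat rational_in_x_and_X rational_in_x_and_add rational_in_x_and_mult
  rational_in_x_and_diff rational_in_x_and_sum

section \<open>Substitution and finite linear systems\<close>

lemma rational_in_x_and_compose_poly:
  assumes "rational_in_x_and t g" "g $ 0 = 0"
  shows "rational_in_x_and t (fps_of_poly p oo g)"
proof (induction p)
  case 0
  then show ?case by (simp add: rational_in_x_and_0)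
next
  case (pCons c p)
  have "fps_of_poly (pCons c p) oo g = fps_const c + g * (fps_of_poly p oo g)"
    using assms(2)
    by (simp add: fps_of_poly_pCons fps_compose_add_distrib fps_compose_mult_distrib mult.commute)
  then show ?case
    using pCons assms(1) by (simp add: rational_in_x_and_intros)
qed

text \<open>Substitute into numerator and denominator separately; \<open>g \<noteq> 0\<close> with
  zero constant term keeps the denominator nonzero.\<close>

lemma rational_in_x_and_compose:
  assumes "rational_fps r" "rational_in_x_and t g" "g $ 0 = 0" "g \<noteq> 0"
  shows "rational_in_x_and t (r oo g)"
proof -
  obtain p q :: "real poly" where "q \<noteq> 0" and eq: "r * fps_of_poly q = fps_of_poly p"
    using assms(1) unfolding rational_fps_def by blast
  have "(r oo g) * (fps_of_poly q oo g) = fps_of_poly p oo g"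
    using assms(3) by (simp add: fps_compose_mult_distrib flip: eq)
  moreover have "fps_of_poly q oo g \<noteq> 0"
    using \<open>q \<noteq> 0\<close> assms(3,4) by (simp add: fps_compose_eq_0_iff)
  ultimately show ?thesis
    using rational_in_x_and_cancel rational_in_x_and_compose_poly[OF assms(2,3)] by metis
qed

text \<open>Gaussian elimination, one unknown at a time. Every coefficient carries a factor
  \<open>fps_X\<close>, so each pivot is a unit, and the reduced system has the same shape.\<close>

lemma rational_in_x_and_linear_system:
  assumes "finite W"
    and "\<And>w. w \<in> W \<Longrightarrow> rational_in_x_and t (c w)"
    and "\<And>w w'. w \<in> W \<Longrightarrow> w' \<in> W \<Longrightarrow> rational_in_x_and t (N w w')"
    and "\<And>w. w \<in> W \<Longrightarrow> f w = c w + fps_X * (\<Sum>w'\<in>W. N w w' * f w')"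
    and "w \<in> W"
  shows "rational_in_x_and t (f w)"
  using assms
proof (induction W arbitrary: c N w rule: finite_induct)
  case empty
  then show ?case by simp
next
  case (insert z W)
  \<comment> \<open>The pivot: the coefficient of \<open>f z\<close> once the diagonal term is moved
    to the left.\<close>
  define u where "u = 1 - fps_X * N z z"
  have u_rat: "rational_in_x_and t u"
    unfolding u_def by (intro rational_in_x_and_intros insert.prems(1,2)) auto
  have "u $ 0 = 1"
    by (simp add: u_def)
  then have u_inv: "inverse u * u = 1"
    by (simp add: inverse_mult_eq_1)
  have inv_rat: "rational_in_x_and t (inverse u)"
    by (rule rational_in_x_and_cancel[OF u_rat])
      (use u_inv \<open>u $ 0 = 1\<close> in \<open>auto simp: rational_in_x_and_1\<close>)
  have "f z = c z + fps_X * (N z z * f z + (\<Sum>w'\<in>W. N z w' * f w'))"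
    using insert.prems(3)[of z] insert.hyps by simp
  then have uf: "u * f z = c z + fps_X * (\<Sum>w'\<in>W. N z w' * f w')"
    unfolding u_def by (simp add: algebra_simps)
  have "f z = inverse u * (u * f z)"
    using u_inv by (simp flip: mult.assoc)
  also have "\<dots> = inverse u * c z + fps_X * (\<Sum>w'\<in>W. inverse u * N z w' * f w')"
    unfolding uf by (simp add: algebra_simps sum_distrib_left)
  finally have fz: "f z = inverse u * c z + fps_X * (\<Sum>w'\<in>W. inverse u * N z w' * f w')" .
  \<comment> \<open>Constant terms and coefficients after substituting \<open>fz\<close> into the
    other equations.\<close>
  define c' where "c' = (\<lambda>w. c w + fps_X * N w z * inverse u * c z)"
  define N' where "N' = (\<lambda>w w'. N w w' + fps_X * N w z * inverse u * N z w')"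
  have rest: "rational_in_x_and t (f w)" if "w \<in> W" for w
  proof (rule insert.IH[of c' N'])
    show "rational_in_x_and t (c' w)" if "w \<in> W" for w
      unfolding c'_def using that by (intro rational_in_x_and_intros insert.prems(1,2) inv_rat) auto
    show "rational_in_x_and t (N' w w')" if "w \<in> W" "w' \<in> W" for w w'
      unfolding N'_def using that by (intro rational_in_x_and_intros insert.prems(1,2) inv_rat) auto
    show "f w = c' w + fps_X * (\<Sum>w'\<in>W. N' w w' * f w')" if "w \<in> W" for w
    proof -
      have "f w = c w + fps_X * (N w z * f z + (\<Sum>w'\<in>W. N w w' * f w'))"
        using insert.prems(3)[of w] that insert.hyps by simp
      also have "\<dots> = c' w + fps_X * (\<Sum>w'\<in>W. N' w w' * f w')"
        unfolding c'_def N'_def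
        by (subst fz) (simp add: algebra_simps sum.distrib sum_distrib_left)
      finally show ?thesis .
    qed
  qed (rule that)
  have "rational_in_x_and t (f z)"
    by (subst fz) (intro rational_in_x_and_intros insert.prems(1,2) inv_rat rest; simp)
  then show ?case
    using rest insert.prems(4) by auto
qed

subsection \<open>The kernel method on the path\<close>

text \<open>Clears the denominator of \<open>t0\<close>, so that later arguments need no division of
  series.\<close>

lemma t0_eq:
  fixes a :: nat
  defines "D \<equiv> 1 + fps_X - of_nat a * fps_X :: real fps"
  shows "2 * D * (fps_X * t0 a)
    = D - fps_radical root 2 (D * (1 - 3 * fps_X - of_nat a * fps_X))" (is "_ = ?N")
proof -
  have D0: "D $ 0 = 1"
    by (simp add: D_def)
  have "?N $ 0 = 0"
    by (simp add: D_def)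
  \<comment> \<open>The exact quotient of the numerator by \<open>fps_X\<close>, available because
    its constant coefficient vanishes.\<close>
  define h where "h = fps_shift 1 ?N"
  have h: "?N = fps_X * h"
    by (rule fps_ext) (use \<open>?N $ 0 = 0\<close> in \<open>simp add: h_def\<close>)
  have "t0 a = ?N / (fps_X * (2 * D))"
    by (simp add: t0_def D_def mult_ac)
  also have "\<dots> = h / (2 * D)"
    unfolding h by simp
  finally have "2 * D * t0 a = h * (2 * D * inverse (2 * D))"
    using D0 by (simp add: fps_divide_unit mult_ac)
  also have "2 * D * inverse (2 * D) = 1"
    using D0 by (intro inverse_mult_eq_1') simp
  finally have "2 * D * t0 a = h"
    by simp
  then show ?thesis
    unfolding h by (simp add: algebra_simps)
qed

text \<open>The kernel equation at \<open>y = Y\<close>, multiplied by \<open>y (1 - y)\<close>. It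
  is equivalent to the quadratic \<open>D * Y - D * Y\<^sup>2 = fps_X\<close>, whose discriminant is
  the radicand of \<open>t0\<close>.\<close>

lemma t0_kernel:
  fixes a :: nat
  defines "Y \<equiv> fps_X * t0 a"
  shows "Y * (1 - Y) * (1 - of_nat a * fps_X) = fps_X * Y\<^sup>2 + fps_X * (1 - Y)"
proof -
  define D :: "real fps" where "D = 1 + fps_X - of_nat a * fps_X"
  define E where "E = D * (1 - 3 * fps_X - of_nat a * fps_X)"
  have "E $ 0 = 1"
    by (simp add: E_def D_def)
  then have sq: "fps_radical root 2 E ^ 2 = E"
    using power_radical[of E root 1] by (simp add: numeral_2_eq_2)
  have "fps_radical root 2 E = D - 2 * D * Y"
    using t0_eq[of a] by (simp add: E_def D_def Y_def)
  \<comment> \<open>The radicand is the discriminant, since \<open>D - 4 * fps_X\<close> is its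
    second factor.\<close>
  moreover have "E = D * (D - 4 * fps_X)"
    by (simp add: E_def D_def algebra_simps)
  ultimately have "(D - 2 * D * Y)\<^sup>2 = D * (D - 4 * fps_X)"
    using sq by simp
  then have "4 * D * (D * Y - D * Y\<^sup>2) = 4 * D * fps_X"
    by (simp add: algebra_simps power2_eq_square)
  moreover have "D \<noteq> 0"
    by (auto simp: D_def fps_eq_iff intro!: exI[of _ 0])
  ultimately have "D * Y - D * Y\<^sup>2 = fps_X"
    by simp
  then show ?thesis
    by (simp add: D_def algebra_simps power2_eq_square)
qed

text \<open>The adjacency operator of the path: it sums \<open>A\<close> over the targets in
  \<open>V'\<close> of the edges leaving the \<open>j\<close>-th path node.\<close>

definition path_op :: "nat \<Rightarrow> (nat \<Rightarrow> real fps) \<Rightarrow> nat \<Rightarrow> real fps" where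
  "path_op a A j = (\<Sum>i<j. A i) + of_nat a * A j + A (Suc j)"

text \<open>The \<open>n\<close>-th iterate of the adjacency operator applied to \<open>r\<close>.
  Thus \<open>path_sol\<close> is the Neumann series of the system, defined coefficient by
  coefficient.\<close>

primrec path_coeff :: "nat \<Rightarrow> (nat \<Rightarrow> real) \<Rightarrow> nat \<Rightarrow> nat \<Rightarrow> real" where
  "path_coeff a r 0 j = r j"
| "path_coeff a r (Suc n) j = (\<Sum>i<j. path_coeff a r n i)
     + of_nat a * path_coeff a r n j + path_coeff a r n (Suc j)"

definition path_sol :: "nat \<Rightarrow> (nat \<Rightarrow> real) \<Rightarrow> nat \<Rightarrow> real fps" where
  "path_sol a r j = Abs_fps (\<lambda>n. path_coeff a r n j)"

lemma path_sol_eq: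
  "path_sol a r j = fps_const (r j) + fps_X * path_op a (path_sol a r) j"
proof (rule fps_ext)
  fix n
  show "path_sol a r j $ n = (fps_const (r j) + fps_X * path_op a (path_sol a r) j) $ n"
    by (cases n) (simp_all add: path_sol_def path_op_def fps_sum_nth flip: fps_of_nat)
qed

text \<open>The factor \<open>fps_X\<close> expresses each coefficient through those of lower order,
  so all vanish by induction, simultaneously for every \<open>j\<close>.\<close>

lemma path_homogeneous_unique:
  assumes "\<And>j. A j = fps_X * path_op a A j"
  shows "A j = 0"
proof -
  have "A j $ n = 0" for n
  proof (induction n arbitrary: j)
    case 0
    show ?case by (subst assms) simp
  next
    case (Suc n)
    show ?case by (subst assms) (simp add: path_op_def fps_sum_nth Suc flip: fps_of_nat)
  qed
  then show ?thesis by (simp add: fps_eq_iff)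
qed

text \<open>The sums are cut off at \<open>n\<close> to avoid series in two variables: the remainder is a multiple of
  \<open>Y ^ n\<close>, hence invisible to coefficients below \<open>n\<close>.\<close>

lemma path_system_partial_sum:
  assumes "\<And>j. A j = fps_const (r j) + fps_X * path_op a A j"
  defines "Y \<equiv> fps_X * t0 a"
  shows "(1 - Y) * Y * (\<Sum>j<n. fps_const (r j) * Y ^ j) =
    fps_X * (1 - Y) * A 0 + Y ^ n * (fps_X * Y * (\<Sum>i<n. A i) - fps_X * (1 - Y) * A n)"
proof (induction n)
  case 0
  then show ?case by simp
next
  case (Suc n)
  define T where "T = (\<Sum>i<n. A i)"
  have r: "fps_const (r n) = (1 - of_nat a * fps_X) * A n - fps_X * T - fps_X * A (Suc n)"
    using assms(1)[of n] by (simp add: path_op_def T_def algebra_simps)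
  have K: "Y * (1 - Y) * (1 - of_nat a * fps_X) = fps_X * Y\<^sup>2 + fps_X * (1 - Y)"
    unfolding Y_def by (rule t0_kernel)
  \<comment> \<open>The kernel equation turns the new summand into a difference of consecutive
    remainders, so the sum telescopes.\<close>
  have "(1 - Y) * Y * fps_const (r n) =
      (Y * (1 - Y) * (1 - of_nat a * fps_X)) * A n - (1 - Y) * Y * (fps_X * T + fps_X * A (Suc n))"
    unfolding r by (simp add: algebra_simps)
  also have "\<dots> = Y * (fps_X * Y * (T + A n) - fps_X * (1 - Y) * A (Suc n))
      - (fps_X * Y * T - fps_X * (1 - Y) * A n)"
    unfolding K by (simp add: algebra_simps power2_eq_square)
  finally have step: "(1 - Y) * Y * fps_const (r n) =
    Y * (fps_X * Y * (T + A n) - fps_X * (1 - Y) * A (Suc n))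
      - (fps_X * Y * T - fps_X * (1 - Y) * A n)" .
  have "(1 - Y) * Y * (\<Sum>j<Suc n. fps_const (r j) * Y ^ j) =
    (1 - Y) * Y * (\<Sum>j<n. fps_const (r j) * Y ^ j) + ((1 - Y) * Y * fps_const (r n)) * Y ^ n"
    by (simp add: algebra_simps)
  also have "\<dots> = fps_X * (1 - Y) * A 0
      + Y ^ Suc n * (fps_X * Y * (\<Sum>i<Suc n. A i) - fps_X * (1 - Y) * A (Suc n))"
    unfolding step Suc.IH by (simp add: T_def algebra_simps)
  finally show ?case .
qed

lemma fps_mult_power_nth_eq_0:
  fixes Y :: "'a::comm_ring_1 fps"
  assumes "Y $ 0 = 0" "k < n"
  shows "(Y ^ n * g) $ k = 0"
  using assms by (simp add: fps_mult_nth fps_pow_nth_below_subdegree startsby_zero_power_prefix)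

lemma path_system_solution_0:
  assumes "\<And>j. A j = fps_const (r j) + fps_X * path_op a A j"
  shows "A 0 = t0 a * (Abs_fps r oo (fps_X * t0 a))"
proof -
  define Y where "Y = fps_X * t0 a"
  have Y0: "Y $ 0 = 0"
    by (simp add: Y_def)
  have "((1 - Y) * Y * (Abs_fps r oo Y)) $ k = (fps_X * (1 - Y) * A 0) $ k" for k
  proof -
    \<comment> \<open>With this cut-off, neither the discarded powers of \<open>Y\<close> nor the
      remainder reach coefficient \<open>k\<close>.\<close>
    define n where "n = Suc k"
    define P where "P = (\<Sum>j<n. fps_const (r j) * Y ^ j)"
    have P: "(Abs_fps r oo Y) $ i = P $ i" if "i \<le> k" for i
    proof -
      have "P $ i = (\<Sum>j<n. r j * (Y ^ j $ i))"
        by (simp add: P_def fps_sum_nth)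
      also have "\<dots> = (\<Sum>j\<in>{0..i}. r j * (Y ^ j $ i))"
        by (rule sum.mono_neutral_right)
          (use that Y0 in \<open>auto simp: n_def startsby_zero_power_prefix\<close>)
      finally show ?thesis
        by (simp add: fps_compose_nth)
    qed
    have "((1 - Y) * Y * (Abs_fps r oo Y)) $ k = ((1 - Y) * Y * P) $ k"
      unfolding fps_mult_nth[of "(1 - Y) * Y"] by (intro sum.cong) (simp_all add: P)
    also have "\<dots> = (fps_X * (1 - Y) * A 0) $ k"
      unfolding P_def Y_def path_system_partial_sum[OF assms]
      using fps_mult_power_nth_eq_0[OF Y0, of k n] by (simp only: Y_def n_def fps_add_nth add_0_right)
    finally show ?thesis .
  qed
  then have "(1 - Y) * Y * (Abs_fps r oo Y) = fps_X * (1 - Y) * A 0"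
    by (simp add: fps_eq_iff)
  \<comment> \<open>Writing the factor \<open>Y\<close> as \<open>fps_X * t0 a\<close> lets
    \<open>fps_X\<close> cancel and leaves \<open>t0 a\<close> in front.\<close>
  then have "(fps_X * (1 - Y)) * (t0 a * (Abs_fps r oo Y)) = (fps_X * (1 - Y)) * A 0"
    by (simp add: Y_def algebra_simps)
  moreover have "1 - Y \<noteq> 0"
    using Y0 by (metis cancel_comm_monoid_add_class.diff_cancel diff_zero eq_iff_diff_eq_0 fps_one_nth zero_neq_one)
  ultimately show ?thesis
    by (simp add: Y_def)
qed

text \<open>The kernel method gives \<open>A 0\<close>; equation \<open>k\<close> then determines
  \<open>A (Suc k)\<close> after a division by \<open>fps_X\<close>.\<close>

lemma path_system_rational:
  assumes "\<And>j. A j = fps_const (r j) + fps_X * path_op a A j" "rational_fps (Abs_fps r)"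
  shows "rational_in_x_and (t0 a) (A j)"
proof (induction j rule: less_induct)
  case (less j)
  show ?case
  proof (cases j)
    case 0
    \<comment> \<open>If this series were zero, the kernel equation would read
      \<open>0 = fps_X\<close>.\<close>
    have nz: "fps_X * t0 a \<noteq> 0"
    proof
      assume "fps_X * t0 a = 0"
      then show False
        using t0_kernel[of a] by simp
    qed
    have "rational_in_x_and (t0 a) (Abs_fps r oo (fps_X * t0 a))"
      by (rule rational_in_x_and_compose[OF assms(2)]) (use nz in \<open>auto intro: rational_in_x_and_intros\<close>)
    then show ?thesis
      by (simp add: 0 path_system_solution_0[OF assms(1)] rational_in_x_and_intros)
  next
    case (Suc k)
    have "A j * fps_X = A k - fps_const (r k) - fps_X * ((\<Sum>i<k. A i) + of_nat a * A k)"
      using assms(1)[of k] by (simp add: Suc path_op_def algebra_simps)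
    moreover have "rational_in_x_and (t0 a) \<dots>"
      by (intro rational_in_x_and_intros less; simp add: Suc)
    ultimately show ?thesis
      using rational_in_x_and_cancel[OF rational_in_x_and_X] by simp
  qed
qed

subsection \<open>Counting vertices of the pattern-avoidance tree\<close>

text \<open>A relational power can be split at its last edge, for inductions on depth, or at its
  first, for the recurrence over children.\<close>

definition level :: "perm set \<Rightarrow> perm \<Rightarrow> nat \<Rightarrow> perm set" where
  "level B u n = {\<pi>. (u, \<pi>) \<in> tree_edges B ^^ n}"

definition depth_gf :: "perm set \<Rightarrow> perm \<Rightarrow> real fps" where
  "depth_gf B u = Abs_fps (\<lambda>n. of_nat (card (level B u n)))"

section \<open>Avoiders and their parents\<close>

lemma S_n_iff: "\<pi> \<in> S_n n \<longleftrightarrow> set \<pi> = {1..n} \<and> distinct \<pi>"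
  by (simp add: S_n_def permutations_of_set_def)

lemma length_S_n:
  assumes "\<pi> \<in> S_n n"
  shows "length \<pi> = n"
proof -
  have "distinct \<pi>" "set \<pi> = {1..n}"
    using assms by (simp_all only: S_n_iff)
  then show ?thesis
    using distinct_card[of \<pi>] by simp
qed

lemma length_Av_n: "\<pi> \<in> Av_n B n \<Longrightarrow> length \<pi> = n"
  by (rule length_S_n) (simp add: Av_n_def)

lemma Av_iff: "\<pi> \<in> Av B \<longleftrightarrow> \<pi> \<noteq> [] \<and> \<pi> \<in> Av_n B (length \<pi>)"
proof -
  have "\<pi> \<in> Av B \<longleftrightarrow> (\<exists>n\<ge>1. \<pi> \<in> Av_n B n)"
    by (auto simp: Av_def)
  also have "\<dots> \<longleftrightarrow> length \<pi> \<ge> 1 \<and> \<pi> \<in> Av_n B (length \<pi>)"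
    using length_Av_n by metis
  finally show ?thesis
    by (simp add: Suc_le_eq)
qed

lemma S_n_1: "S_n 1 = {[1]}"
  by (simp add: S_n_def)

lemma finite_Av_n: "finite (Av_n B n)"
  by (rule finite_subset[of _ "S_n n"]) (auto simp: Av_n_def S_n_def)

lemma perm_parent_S_n:
  assumes "\<pi> \<in> S_n (Suc n)"
  shows "perm_parent \<pi> \<in> S_n n"
proof -
  have "distinct \<pi>" "set \<pi> = {1..Suc n}"
    using assms by (simp_all only: S_n_iff)
  moreover have "{1..Suc n} - {Suc n} = {1..n}"
    by auto
  ultimately show ?thesis
    by (simp only: S_n_iff perm_parent_def length_S_n[OF assms] set_remove1_eq distinct_remove1)
qed

text \<open>An occurrence survives the insertion of a letter: positions behind it shift by one.
  Contrapositively, parents of avoiders avoid.\<close>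

lemma pat_contains_delete:
  assumes "pat_contains (xs @ ys) \<tau>"
  shows "pat_contains (xs @ x # ys) \<tau>"
proof -
  obtain i where mono: "strict_mono_on {..<length \<tau>} i"
    and sub: "i ` {..<length \<tau>} \<subseteq> {..<length (xs @ ys)}"
    and ord: "\<forall>a<length \<tau>. \<forall>b<length \<tau>. (xs @ ys) ! i a < (xs @ ys) ! i b \<longleftrightarrow> \<tau> ! a < \<tau> ! b"
    using assms unfolding pat_contains_def by blast
  define s where "s = (\<lambda>k. if k < length xs then k else Suc k)"
  have s: "strict_mono s"
    by (auto simp: s_def strict_mono_def)
  have nth: "(xs @ x # ys) ! s k = (xs @ ys) ! k" for k
    by (simp add: s_def nth_append Suc_diff_le)
  have "strict_mono_on {..<length \<tau>} (s \<circ> i)"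
    using mono s by (auto simp: strict_mono_on_def strict_mono_def)
  moreover have "(s \<circ> i) ` {..<length \<tau>} \<subseteq> {..<length (xs @ x # ys)}"
    using sub by (auto simp: s_def)
  ultimately show ?thesis
    unfolding pat_contains_def using ord by (intro exI[of _ "s \<circ> i"]) (simp add: nth)
qed

lemma pat_contains_remove1:
  assumes "pat_contains (remove1 x \<pi>) \<tau>"
  shows "pat_contains \<pi> \<tau>"
proof (cases "x \<in> set \<pi>")
  case True
  then obtain ys zs where \<pi>: "\<pi> = ys @ x # zs" "x \<notin> set ys"
    by (meson split_list_first)
  then have "pat_contains (ys @ zs) \<tau>"
    using assms by (simp add: remove1_append)
  then show ?thesis
    unfolding \<pi>(1) by (rule pat_contains_delete)
next
  case False
  then show ?thesis
    using assms by (simp add: remove1_idem)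
qed

lemma perm_parent_Av_n: "\<pi> \<in> Av_n B (Suc n) \<Longrightarrow> perm_parent \<pi> \<in> Av_n B n"
  unfolding Av_n_def perm_parent_def
  using perm_parent_S_n[unfolded perm_parent_def] pat_contains_remove1 by blast

lemma tree_edges_length:
  assumes "(\<sigma>, \<pi>) \<in> tree_edges B"
  shows "length \<pi> = Suc (length \<sigma>)"
proof -
  have "\<pi> \<in> S_n (length \<pi>)" "2 \<le> length \<pi>" "\<sigma> = perm_parent \<pi>"
    using assms by (auto simp: tree_edges_def Av_iff Av_n_def)
  then show ?thesis
    by (auto simp: S_n_iff perm_parent_def length_remove1)
qed

section \<open>Levels of subtrees and their sizes\<close>

lemma level_0 [simp]: "level B u 0 = {u}"
  by (auto simp: level_def)

lemma level_Suc: "level B u (Suc n) = (\<Union>\<pi>\<in>level B u n. children B \<pi>)"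
  by (auto simp: level_def children_def)

lemma level_Suc': "level B u (Suc n) = (\<Union>\<rho>\<in>children B u. level B \<rho> n)"
proof -
  have "tree_edges B ^^ Suc n = tree_edges B O tree_edges B ^^ n"
    by (simp add: relpow_commute)
  then show ?thesis
    unfolding level_def children_def by blast
qed

lemma level_subset:
  assumes "u \<in> Av B"
  shows "level B u n \<subseteq> Av_n B (length u + n)"
proof (induction n)
  case 0
  then show ?case using assms by (simp add: Av_iff)
next
  case (Suc n)
  show ?case
  proof
    fix \<pi> assume "\<pi> \<in> level B u (Suc n)"
    then obtain \<sigma> where "\<sigma> \<in> level B u n" and e: "(\<sigma>, \<pi>) \<in> tree_edges B"
      by (auto simp: level_Suc children_def)
    then have "length \<sigma> = length u + n"
      using Suc by (auto dest: length_Av_n)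
    then show "\<pi> \<in> Av_n B (length u + Suc n)"
      using tree_edges_length[OF e] e by (auto simp: tree_edges_def Av_iff)
  qed
qed

lemma finite_level: "u \<in> Av B \<Longrightarrow> finite (level B u n)"
  by (rule finite_subset[OF level_subset finite_Av_n])

lemma children_subset: "children B u \<subseteq> Av B"
  by (auto simp: children_def tree_edges_def)

lemma finite_children: "u \<in> Av B \<Longrightarrow> finite (children B u)"
  using finite_level[of u B 1] by (simp add: level_Suc)

text \<open>Parents are unique, so the ancestor can be recovered; hence levels below distinct
  children are disjoint.\<close>

lemma level_ancestor: "\<pi> \<in> level B u n \<Longrightarrow> (perm_parent ^^ n) \<pi> = u"
proof (induction n arbitrary: \<pi>)
  case (Suc n)
  then obtain \<sigma> where "\<sigma> \<in> level B u n" "perm_parent \<pi> = \<sigma>"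
    by (auto simp: level_Suc children_def tree_edges_def)
  then show ?case
    using Suc.IH by (simp add: funpow_swap1)
qed simp

lemma card_level_Suc:
  assumes "u \<in> Av B"
  shows "card (level B u (Suc n)) = (\<Sum>\<rho>\<in>children B u. card (level B \<rho> n))"
  unfolding level_Suc'
proof (intro card_UN_disjoint ballI impI)
  show "finite (children B u)"
    by (rule finite_children[OF assms])
  show "finite (level B \<rho> n)" if "\<rho> \<in> children B u" for \<rho>
    using that children_subset by (intro finite_level) blast
  show "level B \<rho> n \<inter> level B \<rho>' n = {}" if "\<rho> \<noteq> \<rho>'" for \<rho> \<rho>'
    using that by (auto dest!: level_ancestor)
qed

text \<open>An isomorphism fixes the root and respects edges in both directions, so by induction it
  maps each level onto the corresponding level.\<close>

lemma perm_equiv_card_level: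
  assumes "perm_equiv B u u'"
  shows "card (level B u n) = card (level B u' n)"
proof -
  define E where "E = tree_edges B"
  define D D' where "D = E\<^sup>* `` {u}" and "D' = E\<^sup>* `` {u'}"
  have "\<exists>f. bij_betw f D D' \<and> f u = u' \<and>
      (\<forall>x\<in>D. \<forall>y\<in>D. (x, y) \<in> E \<inter> D \<times> D \<longleftrightarrow> (f x, f y) \<in> E \<inter> D' \<times> D')"
    using assms
    by (simp only: perm_equiv_def rooted_tree_iso_def subtree_def Let_def E_def D_def D'_def
        prod.case)
  then obtain f where bij: "bij_betw f D D'" and root: "f u = u'"
    and edge: "\<And>x y. x \<in> D \<Longrightarrow> y \<in> D \<Longrightarrow>
      (x, y) \<in> E \<inter> D \<times> D \<longleftrightarrow> (f x, f y) \<in> E \<inter> D' \<times> D'"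
    by blast
  have sub: "level B u n \<subseteq> D" "level B u' n \<subseteq> D'" for n
    by (auto simp: level_def D_def D'_def E_def dest: relpow_imp_rtrancl)
  have "f ` level B u n = level B u' n"
  proof (induction n)
    case 0
    then show ?case by (simp add: root)
  next
    case (Suc n)
    show ?case
    proof (intro equalityI subsetI)
      fix \<pi>' assume "\<pi>' \<in> f ` level B u (Suc n)"
      then obtain \<pi> \<sigma> where "\<pi>' = f \<pi>" "\<pi> \<in> level B u (Suc n)" "\<sigma> \<in> level B u n" "(\<sigma>, \<pi>) \<in> E"
        by (auto simp: level_Suc children_def E_def)
      then have "f \<sigma> \<in> level B u' n" "(f \<sigma>, \<pi>') \<in> E"
        using edge[of \<sigma> \<pi>] sub Suc by blast+
      then show "\<pi>' \<in> level B u' (Suc n)"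
        by (auto simp: level_Suc children_def E_def)
    next
      fix \<pi>' assume *: "\<pi>' \<in> level B u' (Suc n)"
      then obtain \<sigma>' where "\<sigma>' \<in> level B u' n" and e: "(\<sigma>', \<pi>') \<in> E"
        by (auto simp: level_Suc children_def E_def)
      then obtain \<sigma> where \<sigma>: "\<sigma> \<in> level B u n" "\<sigma>' = f \<sigma>"
        using Suc by blast
      \<comment> \<open>Surjectivity supplies a preimage; reflecting the edge then places it one
        level below \<open>\<sigma>\<close>.\<close>
      obtain \<pi> where \<pi>: "\<pi> \<in> D" "\<pi>' = f \<pi>"
        using * sub(2)[of "Suc n"] bij unfolding bij_betw_def by blast
      have "(\<sigma>, \<pi>) \<in> E"
        using edge[of \<sigma> \<pi>] \<sigma> \<pi> e sub * \<open>\<sigma>' \<in> level B u' n\<close> by blast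
      then show "\<pi>' \<in> f ` level B u (Suc n)"
        using \<sigma> \<pi> by (auto simp: level_Suc children_def E_def)
    qed
  qed
  moreover have "inj_on f D"
    using bij by (simp add: bij_betw_def)
  then have "card (f ` level B u n) = card (level B u n)"
    by (intro card_image inj_on_subset[OF _ sub(1)])
  ultimately show ?thesis
    by simp
qed

lemma perm_equiv_depth_gf:
  assumes "perm_equiv B u u'"
  shows "depth_gf B u = depth_gf B u'"
  unfolding depth_gf_def perm_equiv_card_level[OF assms] ..

text \<open>A pattern contained in \<open>[1]\<close> has at most one letter. As
  \<open>B \<subseteq> S\<close> rules out the empty word, only \<open>[1]\<close> itself could
  occur.\<close>

lemma singleton_Av:
  assumes "B \<subseteq> S" "[1] \<notin> B"
  shows "[1] \<in> Av_n B 1"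
proof -
  have "\<not> pat_contains [1] \<tau>" if "\<tau> \<in> B" for \<tau>
  proof
    assume "pat_contains [1] \<tau>"
    then obtain i :: "nat \<Rightarrow> nat" where "strict_mono_on {..<length \<tau>} i" "i ` {..<length \<tau>} \<subseteq> {..<1}"
      by (auto simp: pat_contains_def)
    then have "length \<tau> \<le> 1"
      using card_inj_on_le[of i "{..<length \<tau>}" "{..<1}"] by (simp add: strict_mono_on_imp_inj_on)
    moreover obtain k where k: "k \<ge> 1" "\<tau> \<in> S_n k"
      using \<open>\<tau> \<in> B\<close> assms(1) by (auto simp: S_def)
    ultimately have "k = 1"
      using length_S_n[OF k(2)] by linarith
    then have "\<tau> = [1]"
      using k(2) by (simp only: S_n_1 singleton_iff)
    then show False
      using \<open>\<tau> \<in> B\<close> assms(2) by simp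
  qed
  then show ?thesis
    by (simp only: Av_n_def S_n_1) blast
qed

text \<open>Repeatedly taking parents leads every avoider to the root. Depth starts at 0 and length
  at 1, whence the factor \<open>fps_X\<close> in \<open>Av_gf_eq_depth_gf\<close>.\<close>

lemma level_root:
  assumes "B \<subseteq> S" "[1] \<notin> B"
  shows "level B [1] n = Av_n B (Suc n)"
proof (induction n)
  case 0
  have "Av_n B 1 \<subseteq> {[1]}"
    by (simp only: Av_n_def S_n_1) blast
  then show ?case
    using singleton_Av[OF assms] by auto
next
  case (Suc n)
  have "\<pi> \<in> level B [1] (Suc n)" if "\<pi> \<in> Av_n B (Suc (Suc n))" for \<pi>
  proof -
    have "length \<pi> = Suc (Suc n)"
      using that by (rule length_Av_n)
    moreover have "perm_parent \<pi> \<in> Av_n B (Suc n)"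
      using that by (rule perm_parent_Av_n)
    moreover from this have "length (perm_parent \<pi>) = Suc n"
      by (rule length_Av_n)
    ultimately have "(perm_parent \<pi>, \<pi>) \<in> tree_edges B"
      using that by (auto simp: tree_edges_def Av_iff)
    then show ?thesis
      using Suc \<open>perm_parent \<pi> \<in> Av_n B (Suc n)\<close> by (auto simp: level_Suc children_def)
  qed
  moreover have "level B [1] (Suc n) \<subseteq> Av_n B (Suc (Suc n))"
    using level_subset[of "[1]" B "Suc n"] singleton_Av[OF assms] by (simp add: Av_iff)
  ultimately show ?case by blast
qed

lemma Av_gf_eq_depth_gf:
  assumes "B \<subseteq> S" "[1] \<notin> B"
  shows "Av_gf B = fps_X * depth_gf B [1]"
proof (rule fps_ext)
  fix n
  show "Av_gf B $ n = (fps_X * depth_gf B [1]) $ n"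
    by (cases n) (simp_all add: Av_gf_def depth_gf_def level_root[OF assms, simplified])
qed

text \<open>Group the children of \<open>u\<close> by their unique representatives, which have the
  same level sizes. \<open>T\<close> keeps the sum finite although \<open>V\<close> may be
  infinite.\<close>

lemma depth_gf_rec:
  assumes "node_set B V" "u \<in> Av B" "finite T" "T \<subseteq> V"
    and "\<And>w. w \<in> V \<Longrightarrow> edge_mult B u w > 0 \<Longrightarrow> w \<in> T"
  shows "depth_gf B u = 1 + fps_X * (\<Sum>w\<in>T. of_nat (edge_mult B u w) * depth_gf B w)"
proof -
  define C where "C = (\<lambda>w. {\<rho> \<in> children B u. perm_equiv B \<rho> w})"
  have fin: "finite (C w)" for w
    using finite_children[OF assms(2)] by (simp add: C_def)
  have uniq: "\<exists>!w. w \<in> V \<and> perm_equiv B \<rho> w" if "\<rho> \<in> children B u" for \<rho>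
    using assms(1) children_subset that unfolding node_set_def by blast
  have "\<rho> \<in> (\<Union>w\<in>T. C w)" if \<rho>: "\<rho> \<in> children B u" for \<rho>
  proof -
    obtain w where "w \<in> V" "\<rho> \<in> C w"
      using uniq[OF \<rho>] \<rho> unfolding C_def by blast
    then have "edge_mult B u w > 0"
      using fin[of w] by (auto simp: edge_mult_def C_def card_gt_0_iff)
    then show ?thesis
      using \<open>\<rho> \<in> C w\<close> \<open>w \<in> V\<close> assms(5) by blast
  qed
  then have cover: "children B u = (\<Union>w\<in>T. C w)"
    by (auto simp: C_def)
  have card_level: "card (level B u (Suc n)) = (\<Sum>w\<in>T. edge_mult B u w * card (level B w n))" for n
  proof -
    have "card (level B u (Suc n)) = (\<Sum>\<rho>\<in>(\<Union>w\<in>T. C w). card (level B \<rho> n))"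
      using card_level_Suc[OF assms(2)] cover by simp
    also have "\<dots> = (\<Sum>w\<in>T. \<Sum>\<rho>\<in>C w. card (level B \<rho> n))"
    proof (rule sum.UNION_disjoint)
      show "\<forall>w\<in>T. \<forall>w'\<in>T. w \<noteq> w' \<longrightarrow> C w \<inter> C w' = {}"
        using uniq assms(4) unfolding C_def by blast
    qed (simp_all add: assms(3) fin)
    also have "\<dots> = (\<Sum>w\<in>T. \<Sum>\<rho>\<in>C w. card (level B w n))"
      by (intro sum.cong) (auto simp: C_def intro: perm_equiv_card_level)
    finally show ?thesis
      by (simp add: C_def edge_mult_def)
  qed
  show ?thesis
  proof (rule fps_ext)
    fix n
    show "depth_gf B u $ n =
      (1 + fps_X * (\<Sum>w\<in>T. of_nat (edge_mult B u w) * depth_gf B w)) $ n"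
    proof (cases n)
      case (Suc k)
      then show ?thesis
        using card_level[of k] by (simp add: depth_gf_def fps_sum_nth flip: fps_of_nat)
    qed (simp add: depth_gf_def)
  qed
qed

text \<open>Each successor represents one of the finitely many children.\<close>

lemma finite_successors:
  assumes "node_set B V" "u \<in> Av B"
  shows "finite {w \<in> V. edge_mult B u w > 0}"
proof -
  have "{w \<in> V. edge_mult B u w > 0} \<subseteq> (\<lambda>\<rho>. THE w. w \<in> V \<and> perm_equiv B \<rho> w) ` children B u"
  proof
    fix w assume w: "w \<in> {w \<in> V. edge_mult B u w > 0}"
    then obtain \<rho> where \<rho>: "\<rho> \<in> children B u" "perm_equiv B \<rho> w"
      unfolding edge_mult_def by (metis (no_types, lifting) card.empty empty_Collect_eq mem_Collect_eq less_irrefl)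
    then have "\<exists>!w. w \<in> V \<and> perm_equiv B \<rho> w"
      using assms(1) children_subset unfolding node_set_def by blast
    then have "(THE w. w \<in> V \<and> perm_equiv B \<rho> w) = w"
      using w \<rho> by (intro the1_equality) auto
    then show "w \<in> (\<lambda>\<rho>. THE w. w \<in> V \<and> perm_equiv B \<rho> w) ` children B u"
      using \<rho> by blast
  qed
  then show ?thesis
    using finite_children[OF assms(2)] finite_subset by blast
qed

subsection \<open>Eliminating the path\<close>

lemma path_op_diff: "path_op a (\<lambda>j. f j - g j) j = path_op a f j - path_op a g j"
  by (simp add: path_op_def sum_subtractf algebra_simps)

lemma path_op_sum_mult:
  "path_op a (\<lambda>j. \<Sum>w\<in>W. f w j * c w) j = (\<Sum>w\<in>W. path_op a (f w) j * c w)"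
proof -
  have "(\<Sum>i<j. \<Sum>w\<in>W. f w i * c w) = (\<Sum>w\<in>W. \<Sum>i<j. f w i * c w)"
    by (rule sum.swap)
  then show ?thesis
    by (simp add: path_op_def sum.distrib distrib_right sum_distrib_left sum_distrib_right mult.assoc)
qed

text \<open>The series \<open>G w\<close> do not depend on \<open>j\<close>, so they act as scalars
  in the path system. Both sides solve this system, and their difference solves the homogeneous
  one.\<close>

lemma path_system_superposition:
  assumes "\<And>j. F j = fps_const (r j) + fps_X * (path_op a F j + (\<Sum>w\<in>W. fps_const (s w j) * G w))"
  shows "F j = path_sol a r j + fps_X * (\<Sum>w\<in>W. path_sol a (s w) j * G w)"
proof -
  \<comment> \<open>The part of the solution driven by the nodes in \<open>W\<close>.\<close>
  define H where "H = (\<lambda>j. \<Sum>w\<in>W. path_sol a (s w) j * (fps_X * G w))"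
  have H: "H j = fps_X * (\<Sum>w\<in>W. fps_const (s w j) * G w) + fps_X * path_op a H j" for j
    unfolding H_def path_op_sum_mult
    by (subst path_sol_eq) (simp add: algebra_simps sum.distrib sum_distrib_left)
  have "F j - path_sol a r j - H j = 0"
  proof (rule path_homogeneous_unique[of "\<lambda>j. F j - path_sol a r j - H j" a])
    fix j
    have "F j - path_sol a r j - H j =
      (fps_const (r j) + fps_X * (path_op a F j + (\<Sum>w\<in>W. fps_const (s w j) * G w)))
      - (fps_const (r j) + fps_X * path_op a (path_sol a r) j)
      - (fps_X * (\<Sum>w\<in>W. fps_const (s w j) * G w) + fps_X * path_op a H j)"
      using assms[of j] path_sol_eq[of a r j] H[of j] by simp
    then show "F j - path_sol a r j - H j = fps_X * path_op a (\<lambda>j. F j - path_sol a r j - H j) j"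
      unfolding path_op_diff by (simp add: algebra_simps)
  qed
  then show ?thesis
    by (simp add: H_def sum_distrib_left algebra_simps)
qed

text \<open>Needed for the term 1 in each path equation, which counts the node itself.\<close>

lemma rational_fps_1: "rational_fps (Abs_fps (\<lambda>_. 1))"
proof -
  have "Abs_fps (\<lambda>_. 1) * fps_of_poly [:1, -1:] = (1 :: real fps)"
  proof (rule fps_ext)
    fix n
    show "(Abs_fps (\<lambda>_. 1) * fps_of_poly [:1, -1:]) $ n = (1 :: real fps) $ n"
      by (cases n) (simp_all add: fps_of_poly_pCons algebra_simps)
  qed
  then show ?thesis
    unfolding rational_fps_def by (intro exI[of _ 1] exI[of _ "[:1, -1:]"]) simp
qed

theorem theorem11:
  fixes B V W :: "perm set" and v :: "nat \<Rightarrow> perm" and a :: nat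
  assumes "B \<subseteq> S" and "[1] \<notin> B"
    and "node_set B V"
    and "backward_path_directed V (edge_mult B) v W a"
    and "\<forall>w\<in>W. rational_fps (Abs_fps (\<lambda>j. of_nat (edge_mult B (v j) w)))"
  shows "rational_in_x_and (t0 a) (Av_gf B)"
proof -
  define M where "M = edge_mult B"
  define F where "F = depth_gf B"
  obtain m where V: "V = range v \<union> W" "range v \<inter> W = {}"
    and len_v: "\<And>i. length (v i) = i + m" and len_W: "\<And>w. w \<in> W \<Longrightarrow> length w \<le> m"
    and path: "\<And>i j. i < j \<or> i = Suc j \<Longrightarrow> M (v j) (v i) = 1" and loop: "\<And>i. M (v i) (v i) = a"
    and other: "\<And>c d. c \<in> V \<Longrightarrow> d \<in> V \<Longrightarrow> M c d > 0 \<Longrightarrow>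
        (\<exists>j. \<exists>i\<in>{..<j} \<union> {j, j + 1}. c = v j \<and> d = v i) \<or> c \<in> W \<or> d \<in> W"
    using assms(4) unfolding backward_path_directed_def M_def by fastforce
  have inj_v: "inj v"
    by (rule injI) (metis len_v add_right_cancel)
  have V_Av: "V \<subseteq> Av B"
    using assms(3) by (simp add: node_set_def)
  \<comment> \<open>Bounded length leaves only finitely many candidates for
    \<open>W\<close>.\<close>
  have "w \<in> (\<Union>n\<in>{..m}. Av_n B n)" if "w \<in> W" for w
    using that V_Av len_W[OF that] Av_iff[of w B] unfolding V(1) by blast
  then have "W \<subseteq> (\<Union>n\<in>{..m}. Av_n B n)"
    by blast
  then have fin_W: "finite W"
    by (rule finite_subset) (simp add: finite_Av_n)
  note rec = depth_gf_rec[OF assms(3), folded M_def F_def]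
  have split_sum: "(\<Sum>u\<in>v ` J \<union> W. f u) = (\<Sum>i\<in>J. f (v i)) + (\<Sum>w\<in>W. f w)"
    if "finite J" for J and f :: "perm \<Rightarrow> real fps"
  proof -
    have "(\<Sum>u\<in>v ` J \<union> W. f u) = (\<Sum>u\<in>v ` J. f u) + (\<Sum>w\<in>W. f w)"
      using V(2) that fin_W by (intro sum.union_disjoint) auto
    then show ?thesis
      using inj_v by (simp add: sum.reindex inj_on_def)
  qed

  have F_v: "F (v j) = fps_const 1
      + fps_X * (path_op a (\<lambda>i. F (v i)) j + (\<Sum>w\<in>W. fps_const (of_nat (M (v j) w)) * F w))" for j
  proof -
    have "F (v j) = 1 + fps_X * (\<Sum>u\<in>v ` {..Suc j} \<union> W. of_nat (M (v j) u) * F u)"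
    proof (rule rec)
      \<comment> \<open>Condition (iii) confines the edges outside \<open>W\<close> to the path, and
        injectivity of \<open>v\<close> identifies \<open>j'\<close> with \<open>j\<close>.\<close>
      show "u \<in> v ` {..Suc j} \<union> W" if u: "u \<in> V" "M (v j) u > 0" for u
      proof -
        have "v j \<notin> W"
          using V(2) by blast
        then consider "u \<in> W" | j' i where "i \<in> {..<j'} \<union> {j', j' + 1}" "v j = v j'" "u = v i"
          using other[of "v j" u] u V(1) by blast
        then show ?thesis
          using inj_v by cases (auto dest: injD)
      qed
    qed (use V V_Av fin_W in auto)
    also have "(\<Sum>u\<in>v ` {..Suc j} \<union> W. of_nat (M (v j) u) * F u)
      = path_op a (\<lambda>i. F (v i)) j + (\<Sum>w\<in>W. of_nat (M (v j) w) * F w)"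
      by (simp add: split_sum path_op_def path loop flip: lessThan_Suc_atMost)
    finally show ?thesis
      by (simp add: fps_of_nat)
  qed
  \<comment> \<open>\<open>P\<close> is the response of the path to the constant 1, and
    \<open>R w\<close> its response to the edges into \<open>w\<close>.\<close>
  define P where "P = path_sol a (\<lambda>_. 1)"
  define R where "R = (\<lambda>w. path_sol a (\<lambda>j. of_nat (M (v j) w)))"
  have F_v_eq: "F (v j) = P j + fps_X * (\<Sum>w\<in>W. R w j * F w)" for j
    unfolding P_def R_def by (rule path_system_superposition[OF F_v])
  have P_rat: "rational_in_x_and (t0 a) (P j)" for j
    unfolding P_def by (rule path_system_rational[OF path_sol_eq rational_fps_1])
  have R_rat: "rational_in_x_and (t0 a) (R w j)" if "w \<in> W" for w j
    unfolding R_def M_def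
    by (rule path_system_rational[OF path_sol_eq]) (use assms(5) that in blast)

  \<comment> \<open>Nodes in \<open>W\<close> may point anywhere on the path, but only to finitely
    many nodes.\<close>
  define J where "J = (\<lambda>w. {j. M w (v j) > 0})"
  have fin_J: "finite (J w)" if "w \<in> W" for w
  proof -
    have "finite (v -` {u \<in> V. M w u > 0})"
      using finite_successors[OF assms(3), of w] that V V_Av inj_v
      by (intro finite_vimageI) (auto simp: M_def)
    moreover have "v -` {u \<in> V. M w u > 0} = J w"
      by (auto simp: J_def V(1))
    ultimately show ?thesis by simp
  qed
  \<comment> \<open>The system on \<open>W\<close> after eliminating the path: \<open>N\<close>
    combines direct edges with passages through the path.\<close>
  define c where "c = (\<lambda>w. 1 + fps_X * (\<Sum>j\<in>J w. of_nat (M w (v j)) * P j))"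
  define N where
    "N = (\<lambda>w w'. of_nat (M w w') + fps_X * (\<Sum>j\<in>J w. of_nat (M w (v j)) * R w' j))"
  have F_W: "F w = c w + fps_X * (\<Sum>w'\<in>W. N w w' * F w')" if w: "w \<in> W" for w
  proof -
    have "F w = 1 + fps_X * (\<Sum>u\<in>v ` J w \<union> W. of_nat (M w u) * F u)"
      by (rule rec) (use w V V_Av fin_W fin_J in \<open>auto simp: J_def\<close>)
    also have "(\<Sum>u\<in>v ` J w \<union> W. of_nat (M w u) * F u) =
      (\<Sum>j\<in>J w. of_nat (M w (v j)) * F (v j)) + (\<Sum>w'\<in>W. of_nat (M w w') * F w')"
      using fin_J[OF w] by (rule split_sum)
    also have "(\<Sum>j\<in>J w. of_nat (M w (v j)) * F (v j)) = (\<Sum>j\<in>J w. of_nat (M w (v j)) * P j)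
      + (\<Sum>j\<in>J w. \<Sum>w'\<in>W. fps_X * (of_nat (M w (v j)) * R w' j) * F w')"
      unfolding F_v_eq by (simp add: distrib_left sum.distrib sum_distrib_left mult_ac)
    also have "(\<Sum>j\<in>J w. \<Sum>w'\<in>W. fps_X * (of_nat (M w (v j)) * R w' j) * F w')
      = (\<Sum>w'\<in>W. fps_X * (\<Sum>j\<in>J w. of_nat (M w (v j)) * R w' j) * F w')"
      by (subst sum.swap) (simp add: sum_distrib_left sum_distrib_right)
    finally show ?thesis
      by (simp add: c_def N_def distrib_left distrib_right sum.distrib)
  qed
  have F_W_rat: "rational_in_x_and (t0 a) (F w)" if "w \<in> W" for w
  proof (rule rational_in_x_and_linear_system[OF fin_W _ _ F_W that])
    show "rational_in_x_and (t0 a) (c w)" for w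
      unfolding c_def by (intro rational_in_x_and_intros P_rat)
    show "rational_in_x_and (t0 a) (N w w')" if "w' \<in> W" for w w'
      unfolding N_def by (intro rational_in_x_and_intros R_rat that)
  qed
  have F_v_rat: "rational_in_x_and (t0 a) (F (v j))" for j
    unfolding F_v_eq by (intro rational_in_x_and_intros P_rat R_rat F_W_rat)

  \<comment> \<open>The root is replaced by its representative, for which membership in
    \<open>W\<close> and in the path are both settled.\<close>
  have "[1] \<in> Av B"
    using singleton_Av[OF assms(1,2)] by (simp add: Av_iff)
  then obtain r where r: "r \<in> V" "perm_equiv B [1] r"
    using assms(3) unfolding node_set_def by blast
  then have "rational_in_x_and (t0 a) (F r)"
    using F_W_rat F_v_rat V(1) by blast
  moreover have "Av_gf B = fps_X * F r"
    using Av_gf_eq_depth_gf[OF assms(1,2)] perm_equiv_depth_gf[OF r(2)] by (simp add: F_def)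
  ultimately show ?thesis
    by (simp add: rational_in_x_and_intros)
qed

end
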